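(* Let $n\ge 1$ and let $A:[0,\infty]^n\to[0,\infty]$ be an aggregation function. Then $(A_* )^*\le (A^* )_*$ pointwise.
   Context: An ($n$-ary) aggregation function is a map $A:[0,\infty]^n\to[0,\infty]$ with $A(0,\ldots,0)=0$ that is increasing (in the sense of non-decreasing) in each coordinate. For an aggregation function $A$, the subadditive transformation $A_*:[0,\infty]^n\to[0,\infty]$ and the superadditive transformation $A^*:[0,\infty]^n\to[0,\infty]$ are $$A_*(\mathbf{x})=\inf\Big\{\sum_{i=1}^k A(\mathbf{y}^{(i)})\ \Big|\ \sum_{i=1}^k \mathbf{y}^{(i)}\ge\mathbf{x}\Big\},\qquad A^*(\mathbf{x})=\sup\Big\{\sum_{j=1}^{\ell} A(\mathbf{y}^{(j)})\ \Big|\ \sum_{j=1}^{\ell} \mathbf{y}^{(j)}\le\mathbf{x}\Big\},$$ where $k,\ell$ range over all positive integers, the $\mathbf{y}^{(i)},\mathbf{y}^{(j)}$ range over $[0,\infty]^n$, and vector inequalities are coordinatewise. Both $A_*$ and $A^*$ are again aggregation functions, so $(A_* )^*$ and $(A^* )_*$ are defined by applying the second transformation to the result of the first. *)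

theory Defs
  imports "HOL-Analysis.Analysis"
begin

text \<open>
  \<^typ>\<open>ennreal\<close> is the extended half-line from 0 to infinity (both included), with
  addition saturating at infinity. On \<^typ>\<open>ennreal ^ 'n\<close>, addition, zero and \<open>\<le>\<close> are
  coordinatewise, and the arity is \<open>n = CARD('n) \<ge> 1\<close>.
\<close>

definition aggregation_function :: "(ennreal ^ 'n \<Rightarrow> ennreal) \<Rightarrow> bool" where
  "aggregation_function A \<longleftrightarrow>
     A 0 = 0 \<and>
     (\<forall>i x y. x $ i \<le> y $ i \<and> (\<forall>j. j \<noteq> i \<longrightarrow> x $ j = y $ j) \<longrightarrow> A x \<le> A y)"

definition subadditive_transform :: "(ennreal ^ 'n \<Rightarrow> ennreal) \<Rightarrow> ennreal ^ 'n \<Rightarrow> ennreal" where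
  "subadditive_transform A x =
     Inf {(\<Sum>i=1..k. A (y i)) | (k::nat) y. 1 \<le> k \<and> (\<Sum>i=1..k. y i) \<ge> x}"

definition superadditive_transform :: "(ennreal ^ 'n \<Rightarrow> ennreal) \<Rightarrow> ennreal ^ 'n \<Rightarrow> ennreal" where
  "superadditive_transform A x =
     Sup {(\<Sum>j=1..l. A (y j)) | (l::nat) y. 1 \<le> l \<and> (\<Sum>j=1..l. y j) \<le> x}"

end

theory Submission
  imports Defs
begin

text \<open>
  If \<open>\<Sum>\<^sub>j x\<^sub>j \<le> x \<le> \<Sum>\<^sub>i y\<^sub>i\<close>, a transport plan \<open>z\<^sub>j\<^sub>i\<close> with \<open>\<Sum>\<^sub>i z\<^sub>j\<^sub>i \<ge> x\<^sub>j\<close> and \<open>\<Sum>\<^sub>j z\<^sub>j\<^sub>i \<le> y\<^sub>i\<close>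
  exists coordinatewise. The double sum of the values \<open>A z\<^sub>j\<^sub>i\<close> then separates the two sides:
  summing over \<open>i\<close> first bounds it below by the sum of the subadditive transforms of the \<open>x\<^sub>j\<close>,
  summing over \<open>j\<close> first bounds it above by the sum of the superadditive transforms of the \<open>y\<^sub>i\<close>.
\<close>

text \<open>Each \<open>a j\<close> is split in proportion to the capacities \<open>b i\<close>.
  This requires a total capacity that is finite and nonzero, so the two degenerate totals are
  treated separately.\<close>

lemma ennreal_transport_plan:
  fixes a :: "'a \<Rightarrow> ennreal" and b :: "'b \<Rightarrow> ennreal"
  assumes "finite J" "finite I" and le: "sum a J \<le> sum b I"
  shows "\<exists>z. (\<forall>j\<in>J. a j \<le> (\<Sum>i\<in>I. z j i)) \<and> (\<forall>i\<in>I. (\<Sum>j\<in>J. z j i) \<le> b i)"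
proof (cases "\<exists>i\<in>I. b i = top")
  case True
  then obtain i0 where "i0 \<in> I" "b i0 = top"
    by blast
  then show ?thesis
  \<comment> \<open>An infinite capacity at \<open>i0\<close> can absorb every \<open>a j\<close> in
    full.\<close>
  proof (intro exI[of _ "\<lambda>j i. if i = i0 then a j else 0"] conjI ballI)
    fix i
    show "(\<Sum>j\<in>J. if i = i0 then a j else 0) \<le> b i"
      using \<open>b i0 = top\<close> by (cases "i = i0") simp_all
  qed (use \<open>finite I\<close> \<open>i0 \<in> I\<close> in simp)
next
  case False
  define s where "s = sum b I"
  have s: "s \<noteq> top"
    using False \<open>finite I\<close> by (simp add: s_def)
  show ?thesis
  proof (cases "s = 0")
    case True
    then have "\<forall>j\<in>J. a j = 0"
      using le \<open>finite J\<close> by (simp add: s_def)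
    then show ?thesis
      by (intro exI[of _ "\<lambda>_ _. 0"]) auto
  next
    case False
    show ?thesis
    \<comment> \<open>Summing over \<open>i\<close> gives back \<open>a j\<close> exactly; summing
      over \<open>j\<close> scales \<open>b i\<close> by the ratio \<open>sum a J / s\<close>, which
      is at most 1.\<close>
    proof (intro exI[of _ "\<lambda>j i. a j * b i / s"] conjI ballI)
      fix j
      have "(\<Sum>i\<in>I. a j * b i / s) = a j * s / s"
        by (simp only: s_def divide_ennreal_def sum_distrib_left sum_distrib_right)
      also have "\<dots> = a j"
        using s False by (simp add: ennreal_mult_divide_eq)
      finally show "a j \<le> (\<Sum>i\<in>I. a j * b i / s)"
        by simp
    next
      fix i
      have "(\<Sum>j\<in>J. a j * b i / s) = b i * sum a J / s"
        by (simp only: divide_ennreal_def sum_distrib_left sum_distrib_right mult.commute[of "b i"])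
      also have "\<dots> \<le> b i * s / s"
        using le by (intro divide_right_mono_ennreal mult_left_mono) (auto simp: s_def)
      also have "\<dots> = b i"
        using s False by (simp add: ennreal_mult_divide_eq)
      finally show "(\<Sum>j\<in>J. a j * b i / s) \<le> b i" .
    qed
  qed
qed

text \<open>Order and sums of vectors are coordinatewise, so scalar plans chosen independently for
  each coordinate \<open>c\<close> assemble into one vector-valued plan.\<close>

lemma vec_ennreal_transport_plan:
  fixes a :: "'a \<Rightarrow> ennreal ^ 'n" and b :: "'b \<Rightarrow> ennreal ^ 'n"
  assumes "finite J" "finite I" and le: "sum a J \<le> sum b I"
  obtains z where "\<And>j. j \<in> J \<Longrightarrow> a j \<le> (\<Sum>i\<in>I. z j i)"
    and "\<And>i. i \<in> I \<Longrightarrow> (\<Sum>j\<in>J. z j i) \<le> b i"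
proof -
  have "\<forall>c. \<exists>z. (\<forall>j\<in>J. a j $ c \<le> (\<Sum>i\<in>I. z j i)) \<and> (\<forall>i\<in>I. (\<Sum>j\<in>J. z j i) \<le> b i $ c)"
    using le by (intro allI ennreal_transport_plan assms) (simp add: less_eq_vec_def)
  then obtain z where z: "\<And>c j. j \<in> J \<Longrightarrow> a j $ c \<le> (\<Sum>i\<in>I. z c j i)"
      "\<And>c i. i \<in> I \<Longrightarrow> (\<Sum>j\<in>J. z c j i) \<le> b i $ c"
    by metis
  show thesis
    by (rule that[of "\<lambda>j i. \<chi> c. z c j i"]) (simp_all add: less_eq_vec_def z)
qed

theorem theorem5:
  fixes A :: "ennreal ^ 'n \<Rightarrow> ennreal"
  assumes "aggregation_function A"
  shows "\<forall>x. superadditive_transform (subadditive_transform A) x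
           \<le> subadditive_transform (superadditive_transform A) x"
proof
  fix x :: "ennreal ^ 'n"
  \<comment> \<open>It suffices to compare a single member of the outer \<open>Sup\<close> set with
    a single member of the outer \<open>Inf\<close> set.\<close>
  have "(\<Sum>j=1..l. subadditive_transform A (a j)) \<le> (\<Sum>i=1..k. superadditive_transform A (b i))"
    if "1 \<le> l" and le_x: "(\<Sum>j=1..l. a j) \<le> x" and "1 \<le> k" and x_le: "x \<le> (\<Sum>i=1..k. b i)"
    for k l :: nat and a b
  proof -
    obtain z where z: "\<And>j. j \<in> {1..l} \<Longrightarrow> a j \<le> (\<Sum>i=1..k. z j i)"
      "\<And>i. i \<in> {1..k} \<Longrightarrow> (\<Sum>j=1..l. z j i) \<le> b i"
      using vec_ennreal_transport_plan[OF _ _ order_trans[OF le_x x_le]] by blast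
    have "(\<Sum>j=1..l. subadditive_transform A (a j)) \<le> (\<Sum>j=1..l. \<Sum>i=1..k. A (z j i))"
    proof (rule sum_mono)
      fix j
      assume "j \<in> {1..l}"
      with z(1) \<open>1 \<le> k\<close> show "subadditive_transform A (a j) \<le> (\<Sum>i=1..k. A (z j i))"
        unfolding subadditive_transform_def
        by (intro Inf_lower CollectI exI[of _ k] exI[of _ "z j"]) blast
    qed
    also have "\<dots> = (\<Sum>i=1..k. \<Sum>j=1..l. A (z j i))"
      by (rule sum.swap)
    also have "\<dots> \<le> (\<Sum>i=1..k. superadditive_transform A (b i))"
    proof (rule sum_mono)
      fix i
      assume "i \<in> {1..k}"
      with z(2) \<open>1 \<le> l\<close> show "(\<Sum>j=1..l. A (z j i)) \<le> superadditive_transform A (b i)"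
        unfolding superadditive_transform_def
        by (intro Sup_upper CollectI exI[of _ l] exI[of _ "\<lambda>j. z j i"]) blast
    qed
    finally show ?thesis .
  qed
  then show "superadditive_transform (subadditive_transform A) x
      \<le> subadditive_transform (superadditive_transform A) x"
    unfolding superadditive_transform_def[of "subadditive_transform A"]
      subadditive_transform_def[of "superadditive_transform A"]
    by (intro Sup_least Inf_greatest) blast
qed

end
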